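(* Let $r$ be an integer with $r+1 \geq 3$ and let $K_{1,r}$ be the star on $r+1$ vertices. Then $$\frac{r-1}{2} \leq \liminf_{n\to\infty} \frac{\operatorname{csat}(n,K_{1,r})}{n} \leq \limsup_{n\to\infty} \frac{\operatorname{csat}(n,K_{1,r})}{n} \leq \frac{r-1}{2} + \frac{4r-3}{8r-4}.$$
   Context: All graphs are simple, finite and undirected, and have at least one edge. A "copy of $F$" in $G$ is a (not necessarily induced) subgraph of $G$ isomorphic to $F$. A graph $G$ is $F$-covered if every edge of $G$ lies in a copy of $F$ in $G$. A graph $G$ is $F$-semi-saturated if for every edge $e$ of the complement of $G$, the graph $G+e$ contains more copies of $F$ than $G$ does (equivalently, $G+e$ contains a copy of $F$ using $e$). A graph is $F$-cov-sat if it is both $F$-covered and $F$-semi-saturated. For $n \geq |F|$ (where $|F|$ is the number of vertices of $F$), $\operatorname{csat}(n,F)$ is the minimum number of edges of an $F$-cov-sat graph on exactly $n$ vertices. *)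

theory Defs
  imports Complex_Main "HOL-Library.Extended_Real"
begin

type_synonym 'a graph = "'a set \<times> 'a set set"

abbreviation verts :: "'a graph \<Rightarrow> 'a set" where
  "verts \<equiv> fst"

abbreviation edges :: "'a graph \<Rightarrow> 'a set set" where
  "edges \<equiv> snd"

text \<open>Throughout, graphs have at least one edge.\<close>

definition simple_graph :: "'a graph \<Rightarrow> bool" where
  "simple_graph G \<longleftrightarrow>
     finite (verts G) \<and> (\<forall>e\<in>edges G. e \<subseteq> verts G \<and> card e = 2) \<and> edges G \<noteq> {}"

definition subgraph :: "'a graph \<Rightarrow> 'a graph \<Rightarrow> bool" where
  "subgraph H G \<longleftrightarrow> simple_graph H \<and> verts H \<subseteq> verts G \<and> edges H \<subseteq> edges G"

definition isomorphic :: "'a graph \<Rightarrow> 'b graph \<Rightarrow> bool" where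
  "isomorphic G H \<longleftrightarrow>
     (\<exists>f. bij_betw f (verts G) (verts H) \<and> (\<lambda>e. f ` e) ` edges G = edges H)"

definition copies :: "'b graph \<Rightarrow> 'a graph \<Rightarrow> 'a graph set" where
  "copies F G = {H. subgraph H G \<and> isomorphic H F}"

definition covered :: "'b graph \<Rightarrow> 'a graph \<Rightarrow> bool" where
  "covered F G \<longleftrightarrow> (\<forall>e\<in>edges G. \<exists>H\<in>copies F G. e \<in> edges H)"

definition complement_edges :: "'a graph \<Rightarrow> 'a set set" where
  "complement_edges G = {e. e \<subseteq> verts G \<and> card e = 2 \<and> e \<notin> edges G}"

definition add_edge :: "'a graph \<Rightarrow> 'a set \<Rightarrow> 'a graph" where
  "add_edge G e = (verts G, insert e (edges G))"

definition semi_saturated :: "'b graph \<Rightarrow> 'a graph \<Rightarrow> bool" where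
  "semi_saturated F G \<longleftrightarrow>
     (\<forall>e\<in>complement_edges G. card (copies F (add_edge G e)) > card (copies F G))"

definition cov_sat :: "'b graph \<Rightarrow> 'a graph \<Rightarrow> bool" where
  "cov_sat F G \<longleftrightarrow> covered F G \<and> semi_saturated F G"

text \<open>
  Every finite graph has an isomorphic copy with vertices in \<open>nat\<close>, so this type loses no
  generality. For \<open>n \<ge> card (verts F)\<close> the minimum is attained, since the complete graph
  on \<open>n\<close> vertices is \<open>F\<close>-covered and, having no missing edge, semi-saturated. For smaller \<open>n\<close>
  the value is not meaningful.
\<close>

definition csat :: "nat \<Rightarrow> 'b graph \<Rightarrow> nat" where
  "csat n F =
     (LEAST m. \<exists>G :: nat graph.
        simple_graph G \<and> card (verts G) = n \<and> cov_sat F G \<and> card (edges G) = m)"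

text \<open>The star \<open>K\<^sub>1\<^sub>,\<^sub>r\<close>, with centre 0 and leaves \<open>1, \<dots>, r\<close>.\<close>

definition star :: "nat \<Rightarrow> nat graph" where
  "star r = ({0..r}, (\<lambda>i. {0, i}) ` {1..r})"

end

theory Submission imports Defs begin

text \<open>
  Everything reduces to degrees. An edge lies in a copy of \<open>K\<^sub>1\<^sub>,\<^sub>r\<close> exactly when one of its
  ends has degree at least \<open>r\<close>, since such an end can serve as the centre
  (\<open>edge_in_star_copy_iff\<close>). Hence being covered means that every edge has an end of degree at
  least \<open>r\<close> (\<open>covered_star_iff\<close>), and being semi-saturated means that every non-edge has an end
  of degree at least \<open>r - 1\<close>, because adding the edge raises that degree by one
  (\<open>semi_saturated_star_iff\<close>).

  Lower bound: two distinct vertices of degree below \<open>r - 1\<close> could be neither adjacent nor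
  non-adjacent, so there is at most one such vertex. The handshake identity then gives at
  least \<open>(n - 1) (r - 1) / 2\<close> edges (\<open>cov_sat_star_edges_lower_bound\<close>).

  Upper bound: write \<open>r = k + 1\<close>. In the complete bipartite graph with \<open>k\<close> hubs on one side and
  \<open>m \<ge> k + 1\<close> vertices on the other, the hubs have degree \<open>m \<ge> r\<close>, the other vertices have
  degree \<open>k = r - 1\<close>, and every edge meets a hub. A disjoint union of such graphs is therefore
  cov-sat. Choosing the values \<open>m\<close> as small as \<open>n\<close> allows, a fraction of about
  \<open>(k + 1) / (2k + 1)\<close> of the vertices are not hubs, and each of them accounts for \<open>k\<close> edges, so
  the number of edges is \<open>k (k + 1) / (2k + 1) \<cdot> n + O(1)\<close>. This is below the claimed upper bound
  by \<open>n / 4\<close>, up to the bounded term.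
\<close>

section \<open>Degrees and the handshake identity\<close>

definition neighbours :: "'a graph \<Rightarrow> 'a \<Rightarrow> 'a set" where
  "neighbours G v = {w. {v, w} \<in> edges G}"

definition degree :: "'a graph \<Rightarrow> 'a \<Rightarrow> nat" where
  "degree G v = card (neighbours G v)"

lemma simple_graph_finite_edges:
  assumes "simple_graph G"
  shows "finite (edges G)"
proof (rule finite_subset)
  show "edges G \<subseteq> Pow (verts G)" "finite (Pow (verts G))"
    using assms by (auto simp: simple_graph_def)
qed

lemma neighbours_subset_verts:
  assumes "simple_graph G"
  shows "neighbours G v \<subseteq> verts G"
  using assms by (auto simp: neighbours_def simple_graph_def)

lemma finite_neighbours:
  assumes "simple_graph G"
  shows "finite (neighbours G v)"
  using finite_subset[OF neighbours_subset_verts[OF assms]] assms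
  by (auto simp: simple_graph_def)

lemma not_own_neighbour:
  assumes "simple_graph G"
  shows "v \<notin> neighbours G v"
proof
  assume "v \<in> neighbours G v"
  then have "{v} \<in> edges G" by (simp add: neighbours_def)
  then have "card {v} = 2" using assms unfolding simple_graph_def by blast
  then show False by simp
qed

lemma edge_at_vertexE:
  assumes "simple_graph G" "e \<in> edges G" "v \<in> e"
  obtains w where "e = {v, w}" "w \<noteq> v"
proof -
  have "card e = 2" using assms by (auto simp: simple_graph_def)
  then obtain x y where "e = {x, y}" "x \<noteq> y" by (auto simp: card_2_iff)
  then show thesis using that assms(3) by (metis insertE insert_commute singletonD)
qed

lemma degree_eq_card_incident:
  assumes "simple_graph G"
  shows "degree G v = card {e \<in> edges G. v \<in> e}"
proof -
  have "inj_on (\<lambda>w. {v, w}) (neighbours G v)"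
    by (auto simp: inj_on_def doubleton_eq_iff)
  moreover have "(\<lambda>w. {v, w}) ` neighbours G v = {e \<in> edges G. v \<in> e}"
    using assms by (auto simp: neighbours_def elim: edge_at_vertexE)
  ultimately show ?thesis
    unfolding degree_def by (metis card_image)
qed

lemma handshake:
  assumes "simple_graph G"
  shows "(\<Sum>v\<in>verts G. degree G v) = 2 * card (edges G)"
proof -
  have "card {v \<in> verts G. v \<in> e} = 2" if "e \<in> edges G" for e
  proof -
    have "{v \<in> verts G. v \<in> e} = e" "card e = 2"
      using that assms by (auto simp: simple_graph_def)
    then show ?thesis by simp
  qed
  then have "(\<Sum>v\<in>verts G. card {e \<in> edges G. v \<in> e}) = 2 * card (edges G)"
    using assms simple_graph_finite_edges[OF assms]
    by (intro sum_multicount) (auto simp: simple_graph_def)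
  then show ?thesis
    by (simp add: degree_eq_card_incident[OF assms])
qed

lemma simple_graph_add_edge:
  assumes "simple_graph G" "e \<in> complement_edges G"
  shows "simple_graph (add_edge G e)"
  using assms by (auto simp: simple_graph_def complement_edges_def add_edge_def)

lemma degree_add_edge:
  assumes "simple_graph G" "e \<in> complement_edges G" "v \<in> e"
  shows "degree (add_edge G e) v = Suc (degree G v)"
proof -
  have "{f \<in> edges (add_edge G e). v \<in> f} = insert e {f \<in> edges G. v \<in> f}"
    using assms(3) by (auto simp: add_edge_def)
  moreover have "e \<notin> edges G"
    using assms(2) by (simp add: complement_edges_def)
  ultimately show ?thesis
    using simple_graph_finite_edges[OF assms(1)]
    by (simp add: degree_eq_card_incident assms(1) simple_graph_add_edge[OF assms(1,2)])
qed

section \<open>Copies of stars\<close>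

text \<open>
  All \<open>r\<close> edges of a copy of the star contain the preimage of the centre, which is thus an end
  of each of them.
\<close>

lemma star_copy_edge_has_large_degree:
  assumes G: "simple_graph G" and H: "H \<in> copies (star r) G" and e: "e \<in> edges H"
  shows "\<exists>v\<in>e. degree G v \<ge> r"
proof -
  have sub: "simple_graph H" "edges H \<subseteq> edges G"
    using H by (auto simp: copies_def subgraph_def)
  obtain f where f: "bij_betw f (verts H) (verts (star r))"
    and im: "(\<lambda>e. f ` e) ` edges H = edges (star r)"
    using H by (auto simp: copies_def isomorphic_def)
  have centre: "\<exists>x\<in>d. f x = 0" if "d \<in> edges H" for d
  proof -
    have "f ` d \<in> edges (star r)" using im that by blast
    then have "0 \<in> f ` d" by (auto simp: star_def)
    then show ?thesis by force
  qed
  obtain v where v: "v \<in> e" "f v = 0" using centre[OF e] by blast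
  have in_verts: "d \<subseteq> verts H" if "d \<in> edges H" for d
    using sub(1) that by (auto simp: simple_graph_def)
  have "v \<in> d" if d: "d \<in> edges H" for d
  proof -
    obtain x where x: "x \<in> d" "f x = 0" using centre[OF d] by blast
    have "x \<in> verts H" "v \<in> verts H" using v x in_verts[OF d] in_verts[OF e] by auto
    then have "x = v"
      using inj_onD[OF bij_betw_imp_inj_on[OF f], of x v] v x by simp
    then show ?thesis using x by simp
  qed
  then have incident: "edges H \<subseteq> {d \<in> edges G. v \<in> d}" using sub(2) by blast
  have "inj_on (\<lambda>i. {0::nat, i}) {1..r}"
    by (auto simp: inj_on_def doubleton_eq_iff)
  then have "r = card (edges (star r))"
    by (simp add: star_def card_image)
  also have "\<dots> \<le> card (edges H)"
    using card_image_le[OF simple_graph_finite_edges[OF sub(1)]] im by metis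
  also have "\<dots> \<le> degree G v"
    unfolding degree_eq_card_incident[OF G]
    using incident simple_graph_finite_edges[OF G] by (intro card_mono) auto
  finally show ?thesis using v by blast
qed

lemma star_on_neighbours_isomorphic:
  assumes "finite L" "card L = r" "v \<notin> L"
  shows "isomorphic (insert v L, (\<lambda>w. {v, w}) ` L) (star r)"
proof -
  obtain h where h: "bij_betw h L {1..r}"
    using assms(1,2) by (metis card_atLeastAtMost diff_Suc_1 finite_atLeastAtMost finite_same_card_bij)
  define f where "f x = (if x = v then 0 else h x)" for x
  have fL: "f ` L = {1..r}" and inj: "inj_on f L"
    using h assms(3) by (auto simp: f_def bij_betw_def inj_on_def image_iff; metis)+
  have "bij_betw f (insert v L) {0..r}"
  proof -
    have "bij_betw f L {1..r}" using fL inj by (simp add: bij_betw_def)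
    moreover have "insert (f v) {1..r} = {0..r}" by (auto simp: f_def)
    ultimately show ?thesis
      using notIn_Un_bij_betw[of v L f "{1..r}"] assms(3) by (simp add: f_def)
  qed
  moreover have "f v = 0" by (simp add: f_def)
  then have "(\<lambda>e. f ` e) ` (\<lambda>w. {v, w}) ` L = (\<lambda>i. {0, i}) ` {1..r}"
    unfolding fL[symmetric] image_image by simp
  ultimately show ?thesis
    unfolding isomorphic_def star_def by (intro exI[of _ f]) auto
qed

text \<open>
  Conversely, among the at least \<open>r\<close> neighbours of an end of large degree, a set of \<open>r\<close> leaves can
  be chosen so as to contain the other end of the given edge.
\<close>

lemma large_degree_edge_in_star_copy:
  assumes G: "simple_graph G" and "r \<ge> 1"
    and e: "e \<in> edges G" "v \<in> e" and deg: "degree G v \<ge> r"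
  shows "\<exists>H\<in>copies (star r) G. e \<in> edges H"
proof -
  obtain w where w: "e = {v, w}" using edge_at_vertexE[OF G e] by blast
  then have "{w} \<subseteq> neighbours G v" using e by (simp add: neighbours_def)
  then obtain L where L: "{w} \<subseteq> L" "L \<subseteq> neighbours G v" "card L = r"
    using exists_subset_between[of "{w}" r "neighbours G v"] finite_neighbours[OF G] deg \<open>r \<ge> 1\<close>
    by (auto simp: degree_def)
  have "finite L" using L(2) finite_neighbours[OF G] by (rule finite_subset)
  have "v \<notin> L" using L(2) not_own_neighbour[OF G] by blast
  let ?H = "(insert v L, (\<lambda>w. {v, w}) ` L)"
  have edges: "edges ?H \<subseteq> edges G" using L(2) by (auto simp: neighbours_def)
  have "v \<in> verts G" using G e by (auto simp: simple_graph_def)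
  then have verts: "verts ?H \<subseteq> verts G"
    using L(2) neighbours_subset_verts[OF G] by auto
  have "simple_graph ?H"
    using \<open>finite L\<close> \<open>v \<notin> L\<close> L(1) by (auto simp: simple_graph_def card_2_iff)
  then have "?H \<in> copies (star r) G"
    using edges verts star_on_neighbours_isomorphic[OF \<open>finite L\<close> L(3) \<open>v \<notin> L\<close>]
    by (simp add: copies_def subgraph_def)
  moreover have "e \<in> edges ?H" using L(1) w by auto
  ultimately show ?thesis by blast
qed

lemma edge_in_star_copy_iff:
  assumes "simple_graph G" "r \<ge> 1" "e \<in> edges G"
  shows "(\<exists>H\<in>copies (star r) G. e \<in> edges H) \<longleftrightarrow> (\<exists>v\<in>e. degree G v \<ge> r)"
  using star_copy_edge_has_large_degree[OF assms(1)] large_degree_edge_in_star_copy[OF assms]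
  by blast

lemma covered_star_iff:
  assumes "simple_graph G" "r \<ge> 1"
  shows "covered (star r) G \<longleftrightarrow> (\<forall>e\<in>edges G. \<exists>v\<in>e. degree G v \<ge> r)"
  unfolding covered_def using edge_in_star_copy_iff[OF assms] by blast

lemma finite_copies:
  assumes "simple_graph G"
  shows "finite (copies F G)"
proof (rule finite_subset)
  show "copies F G \<subseteq> Pow (verts G) \<times> Pow (edges G)"
    by (auto simp: copies_def subgraph_def)
  show "finite (Pow (verts G) \<times> Pow (edges G))"
    using assms simple_graph_finite_edges[OF assms] by (simp add: simple_graph_def)
qed

text \<open>
  The copies of \<open>F\<close> in \<open>G\<close> are precisely those copies in \<open>G + e\<close> that avoid \<open>e\<close>, and there are
  finitely many copies; so the count grows exactly when some copy uses \<open>e\<close>.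
\<close>

lemma more_copies_iff_copy_uses_edge:
  assumes "simple_graph G" "e \<in> complement_edges G"
  shows "card (copies F (add_edge G e)) > card (copies F G)
    \<longleftrightarrow> (\<exists>H\<in>copies F (add_edge G e). e \<in> edges H)"
proof -
  have fin: "finite (copies F (add_edge G e))"
    by (rule finite_copies[OF simple_graph_add_edge[OF assms]])
  have sub: "copies F G \<subseteq> copies F (add_edge G e)"
    by (auto simp: copies_def subgraph_def add_edge_def)
  have "H \<in> copies F G \<longleftrightarrow> e \<notin> edges H" if "H \<in> copies F (add_edge G e)" for H
    using that assms(2) by (auto simp: copies_def subgraph_def add_edge_def complement_edges_def)
  then have "(\<exists>H\<in>copies F (add_edge G e). e \<in> edges H)
    \<longleftrightarrow> copies F G \<noteq> copies F (add_edge G e)"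
    using sub by blast
  also have "\<dots> \<longleftrightarrow> card (copies F G) < card (copies F (add_edge G e))"
    using psubset_card_mono[OF fin] sub by (metis less_irrefl psubsetI)
  finally show ?thesis by simp
qed

lemma semi_saturated_star_iff:
  assumes "simple_graph G"
  shows "semi_saturated (star (Suc k)) G
    \<longleftrightarrow> (\<forall>e\<in>complement_edges G. \<exists>v\<in>e. degree G v \<ge> k)"
proof -
  have "card (copies (star (Suc k)) (add_edge G e)) > card (copies (star (Suc k)) G)
    \<longleftrightarrow> (\<exists>v\<in>e. degree G v \<ge> k)" if e: "e \<in> complement_edges G" for e
  proof -
    have "e \<in> edges (add_edge G e)" by (simp add: add_edge_def)
    then have "(\<exists>H\<in>copies (star (Suc k)) (add_edge G e). e \<in> edges H)
      \<longleftrightarrow> (\<exists>v\<in>e. degree (add_edge G e) v \<ge> Suc k)"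
      by (intro edge_in_star_copy_iff simple_graph_add_edge assms e) auto
    then show ?thesis
      using more_copies_iff_copy_uses_edge[OF assms e, of "star (Suc k)"]
        degree_add_edge[OF assms e] by simp
  qed
  then show ?thesis unfolding semi_saturated_def by blast
qed

section \<open>The lower bound\<close>

text \<open>
  Vertices of degree below \<open>k\<close> are pairwise non-adjacent by coveredness and pairwise adjacent by
  semi-saturation, so at most one exists; it may have degree \<open>0\<close>, whence the loss of one vertex.
\<close>

lemma cov_sat_star_edges_lower_bound:
  assumes G: "simple_graph G" and cs: "cov_sat (star (Suc k)) G"
  shows "(card (verts G) - 1) * k \<le> 2 * card (edges G)"
proof -
  define low where "low = {v \<in> verts G. degree G v < k}"
  have fin: "finite (verts G)" using G by (simp add: simple_graph_def)
  then have "finite low" by (simp add: low_def)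
  have cov: "\<forall>e\<in>edges G. \<exists>v\<in>e. degree G v \<ge> Suc k"
    and sat: "\<forall>e\<in>complement_edges G. \<exists>v\<in>e. degree G v \<ge> k"
    using cs covered_star_iff[OF G] semi_saturated_star_iff[OF G] by (auto simp: cov_sat_def)
  have "u = v" if "u \<in> low" "v \<in> low" for u v
  proof (rule ccontr)
    assume "u \<noteq> v"
    then have "{u, v} \<in> edges G \<or> {u, v} \<in> complement_edges G"
      using that by (auto simp: complement_edges_def low_def)
    then have "\<exists>x\<in>{u, v}. degree G x \<ge> k" using cov sat by (meson Suc_leD)
    then show False using that by (auto simp: low_def)
  qed
  then have "card low \<le> 1" using \<open>finite low\<close> by (simp add: card_le_Suc0_iff_eq)
  moreover have "card (verts G - low) = card (verts G) - card low"
    using \<open>finite low\<close> by (intro card_Diff_subset) (auto simp: low_def)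
  ultimately have "(card (verts G) - 1) * k \<le> card (verts G - low) * k"
    by (intro mult_right_mono) auto
  also have "\<dots> = (\<Sum>v\<in>verts G - low. k)" by simp
  also have "\<dots> \<le> (\<Sum>v\<in>verts G - low. degree G v)"
    by (intro sum_mono) (auto simp: low_def)
  also have "\<dots> \<le> (\<Sum>v\<in>verts G. degree G v)"
    using fin by (intro sum_mono2) auto
  finally show ?thesis using handshake[OF G] by simp
qed

section \<open>Disjoint unions of complete bipartite graphs\<close>

text \<open>
  The disjoint union of \<open>q\<close> complete bipartite graphs with \<open>k\<close> hubs each. The hubs are the
  numbers below \<open>q k\<close>, the \<open>g\<close>-th block of \<open>k\<close> consecutive ones belonging to component \<open>g\<close>; the
  remaining vertices are dealt out to the components by their residue modulo \<open>q\<close>.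
\<close>

definition biclique_union :: "nat \<Rightarrow> nat \<Rightarrow> nat \<Rightarrow> nat graph" where
  "biclique_union k q n =
     ({0..<n}, (\<lambda>(v, j). {v, (v mod q) * k + j}) ` ({q * k..<n} \<times> {..<k}))"

lemma hub_in_block:
  fixes k q v j :: nat
  assumes "q \<ge> 1" "j < k"
  shows "(v mod q) * k + j < q * k"
proof -
  have "(v mod q) * k + j < Suc (v mod q) * k" using assms(2) by simp
  also have "\<dots> \<le> q * k" using assms(1) by (intro mult_right_mono) (auto simp: Suc_le_eq)
  finally show ?thesis .
qed

lemma simple_graph_biclique_union:
  assumes "k \<ge> 1" "q \<ge> 1" "q * k < n"
  shows "simple_graph (biclique_union k q n)"
proof -
  let ?G = "biclique_union k q n"
  have "e \<subseteq> verts ?G \<and> card e = 2" if e: "e \<in> edges ?G" for e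
  proof -
    obtain v j where *: "e = {v, v mod q * k + j}" "q * k \<le> v" "v < n" "j < k"
      using e by (auto simp: biclique_union_def)
    have "v mod q * k + j < q * k" by (rule hub_in_block[OF assms(2) *(4)])
    then show ?thesis using * by (auto simp: biclique_union_def card_2_iff)
  qed
  moreover have "({q * k..<n} \<times> {..<k}) \<noteq> {}"
    using assms by (auto simp: lessThan_empty_iff)
  then have "edges ?G \<noteq> {}" unfolding biclique_union_def snd_conv by blast
  moreover have "finite (verts ?G)" by (simp add: biclique_union_def)
  ultimately show ?thesis unfolding simple_graph_def by blast
qed

lemma card_edges_biclique_union:
  "card (edges (biclique_union k q n)) \<le> (n - q * k) * k"
proof -
  have "card (edges (biclique_union k q n)) \<le> card ({q * k..<n} \<times> {..<k})"
    unfolding biclique_union_def snd_conv by (rule card_image_le) simp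
  then show ?thesis by (simp add: card_cartesian_product)
qed

lemma degree_nonhub:
  assumes "simple_graph (biclique_union k q n)" "q * k \<le> v" "v < n"
  shows "degree (biclique_union k q n) v \<ge> k"
proof -
  have "(\<lambda>j. (v mod q) * k + j) ` {..<k} \<subseteq> neighbours (biclique_union k q n) v"
    using assms(2,3) by (force simp: neighbours_def biclique_union_def)
  then have "card ((\<lambda>j. (v mod q) * k + j) ` {..<k}) \<le> degree (biclique_union k q n) v"
    unfolding degree_def by (intro card_mono finite_neighbours assms(1))
  then show ?thesis by (simp add: card_image)
qed

text \<open>
  The hub \<open>b\<close> belongs to component \<open>b div k\<close>. Since \<open>n \<ge> q k + q (k + 1)\<close>, at least \<open>k + 1\<close> of the
  vertices that are not hubs have this residue.
\<close>

lemma degree_hub: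
  assumes "simple_graph (biclique_union k q n)" "q * (2 * k + 1) \<le> n" "b < q * k"
  shows "degree (biclique_union k q n) b \<ge> Suc k"
proof -
  have "k > 0" "q > 0" using assms(3) by (auto intro: Nat.gr0I)
  have g: "b div k < q" using assms(3) by (rule less_mult_imp_div_less)
  let ?v = "\<lambda>i. q * (k + i) + b div k"
  have "?v i \<in> neighbours (biclique_union k q n) b" if "i \<le> k" for i
  proof -
    have "?v i < q * (k + i) + q" using g by simp
    also have "\<dots> = q * (k + i + 1)" by simp
    also have "\<dots> \<le> q * (2 * k + 1)" using that by (intro mult_left_mono) auto
    finally have "?v i < n" using assms(2) by simp
    moreover have "q * k \<le> ?v i" by (simp add: algebra_simps)
    moreover have "?v i mod q = b div k" using g by simp
    then have "{b, ?v i} = {?v i, ?v i mod q * k + b mod k}" by auto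
    moreover have "b mod k < k" using \<open>k > 0\<close> by simp
    ultimately show ?thesis
      unfolding neighbours_def biclique_union_def mem_Collect_eq snd_conv
      by (intro image_eqI[of _ _ "(?v i, b mod k)"]) auto
  qed
  then have "?v ` {..k} \<subseteq> neighbours (biclique_union k q n) b" by blast
  then have "card (?v ` {..k}) \<le> degree (biclique_union k q n) b"
    unfolding degree_def by (intro card_mono finite_neighbours assms(1))
  moreover have "inj_on ?v {..k}" using \<open>q > 0\<close> by (auto simp: inj_on_def)
  ultimately show ?thesis by (simp add: card_image)
qed

lemma cov_sat_biclique_union:
  assumes "k \<ge> 1" "q \<ge> 1" "q * (2 * k + 1) \<le> n"
  shows "simple_graph (biclique_union k q n)" "cov_sat (star (Suc k)) (biclique_union k q n)"
proof -
  let ?G = "biclique_union k q n"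
  have "q * k < q * (2 * k + 1)" using assms(2) by simp
  then have "q * k < n" using assms(3) by linarith
  then show G: "simple_graph ?G" by (rule simple_graph_biclique_union[OF assms(1,2)])
  have "\<exists>v\<in>e. degree ?G v \<ge> Suc k" if e: "e \<in> edges ?G" for e
  proof -
    obtain v j where "e = {v, v mod q * k + j}" "j < k"
      using e by (auto simp: biclique_union_def)
    then show ?thesis
      using degree_hub[OF G assms(3)] hub_in_block[OF assms(2)] by blast
  qed
  then have "covered (star (Suc k)) ?G" using covered_star_iff[OF G] by simp
  moreover have deg: "degree ?G v \<ge> k" if "v < n" for v
    using degree_nonhub[OF G] degree_hub[OF G assms(3)] that by (meson Suc_leD not_le)
  have "\<exists>v\<in>e. degree ?G v \<ge> k" if "e \<in> complement_edges ?G" for e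
  proof -
    have "e \<noteq> {}" "e \<subseteq> {0..<n}"
      using that by (auto simp: complement_edges_def biclique_union_def)
    then show ?thesis using deg by fastforce
  qed
  then have "semi_saturated (star (Suc k)) ?G" using semi_saturated_star_iff[OF G] by simp
  ultimately show "cov_sat (star (Suc k)) ?G" by (simp add: cov_sat_def)
qed

section \<open>Bounds on the cov-sat number of a star\<close>

text \<open>
  The existence of some cov-sat graph on \<open>n\<close> vertices is needed for the lower bound as well: without
  it the minimum defining the cov-sat number would be a default value.
\<close>

lemma csat_star_bounds:
  assumes "k \<ge> 1" "q \<ge> 1" "q * (2 * k + 1) \<le> n"
  shows "(n - 1) * k \<le> 2 * csat n (star (Suc k))"
    and "csat n (star (Suc k)) \<le> (n - q * k) * k"
proof -
  let ?P = "\<lambda>m. \<exists>G :: nat graph. simple_graph G \<and> card (verts G) = n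
    \<and> cov_sat (star (Suc k)) G \<and> card (edges G) = m"
  have "card (verts (biclique_union k q n)) = n" by (simp add: biclique_union_def)
  then have P: "?P (card (edges (biclique_union k q n)))"
    using cov_sat_biclique_union[OF assms] by blast
  have "?P (csat n (star (Suc k)))" unfolding csat_def using P by (rule LeastI)
  then obtain G :: "nat graph" where "simple_graph G" "card (verts G) = n"
    "cov_sat (star (Suc k)) G" "card (edges G) = csat n (star (Suc k))" by blast
  then show "(n - 1) * k \<le> 2 * csat n (star (Suc k))"
    using cov_sat_star_edges_lower_bound[of G k] by simp
  have "csat n (star (Suc k)) \<le> card (edges (biclique_union k q n))"
    unfolding csat_def using P by (rule Least_le)
  then show "csat n (star (Suc k)) \<le> (n - q * k) * k"
    using card_edges_biclique_union[of k q n] by linarith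
qed

text \<open>
  The edge bound \<open>(n - q k) k\<close> decreases in \<open>q\<close>, so the number of components is taken as large as
  \<open>q (2k + 1) \<le> n\<close> permits.
\<close>

lemma csat_star_ratio_bounds:
  assumes "k \<ge> 1" "n \<ge> 2 * k + 1"
  shows "real k / 2 - real k / 2 / real n \<le> real (csat n (star (Suc k))) / real n"
    and "real (csat n (star (Suc k))) / real n
      \<le> real k * (real k + 1) / (2 * real k + 1) + (real k)\<^sup>2 / real n"
proof -
  define q where "q = n div (2 * k + 1)"
  have q: "q \<ge> 1" "q * (2 * k + 1) \<le> n"
    using assms(2) unfolding q_def by (auto simp: Suc_le_eq div_greater_zero_iff simp del: mult_Suc_right)
  note bounds = csat_star_bounds[OF assms(1) q]
  have n: "real n > 0" using assms(2) by simp
  have "real ((n - 1) * k) \<le> real (2 * csat n (star (Suc k)))"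
    using bounds(1) by (simp only: of_nat_le_iff)
  then have "(real n - 1) * real k \<le> 2 * real (csat n (star (Suc k)))"
    using assms(2) by simp
  then have "(real k / 2 - real k / 2 / real n) * real n \<le> real (csat n (star (Suc k)))"
    using n by (simp add: algebra_simps)
  then show "real k / 2 - real k / 2 / real n \<le> real (csat n (star (Suc k))) / real n"
    using n by (simp add: pos_le_divide_eq)
  have "n < (q + 1) * (2 * k + 1)"
    using dividend_less_div_times[of "2 * k + 1" n] by (simp add: q_def algebra_simps)
  then have "real n < real ((q + 1) * (2 * k + 1))" by (simp only: of_nat_less_iff)
  then have "real n < (real q + 1) * (2 * real k + 1)" by (simp add: algebra_simps)
  then have qn: "real n / (2 * real k + 1) - 1 \<le> real q" by (simp add: field_simps)
  have "q * k \<le> n" using q(2) by (simp add: algebra_simps)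
  have "real (csat n (star (Suc k))) \<le> real ((n - q * k) * k)"
    using bounds(2) by (simp only: of_nat_le_iff)
  also have "\<dots> = (real n - real q * real k) * real k"
    using \<open>q * k \<le> n\<close> by (simp add: of_nat_diff)
  also have "\<dots> \<le> (real n - (real n / (2 * real k + 1) - 1) * real k) * real k"
    using qn by (intro mult_right_mono diff_left_mono) auto
  also have "\<dots> = real k * (real k + 1) * (real n / (2 * real k + 1)) + (real k)\<^sup>2"
  proof -
    define y where "y = real n / (2 * real k + 1)"
    have "real n = y * (2 * real k + 1)" by (simp add: y_def)
    then show ?thesis
      unfolding y_def[symmetric] by (simp add: algebra_simps power2_eq_square)
  qed
  also have "\<dots> = (real k * (real k + 1) / (2 * real k + 1) + (real k)\<^sup>2 / real n) * real n"
    using n by (simp add: distrib_right)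
  finally show "real (csat n (star (Suc k))) / real n
      \<le> real k * (real k + 1) / (2 * real k + 1) + (real k)\<^sup>2 / real n"
    using n by (simp add: pos_divide_le_eq)
qed

theorem theorem4p4:
  fixes r :: nat
  assumes "r + 1 \<ge> 3"
  shows "ereal ((real r - 1) / 2) \<le> liminf (\<lambda>n. ereal (real (csat n (star r)) / real n))
    \<and> liminf (\<lambda>n. ereal (real (csat n (star r)) / real n))
        \<le> limsup (\<lambda>n. ereal (real (csat n (star r)) / real n))
    \<and> limsup (\<lambda>n. ereal (real (csat n (star r)) / real n))
        \<le> ereal ((real r - 1) / 2 + (4 * real r - 3) / (8 * real r - 4))"
proof -
  obtain k where r: "r = Suc k" and k: "k \<ge> 1"
    using assms by (cases r) auto
  let ?c = "\<lambda>n. ereal (real (csat n (star r)) / real n)"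
  let ?l = "\<lambda>n. ereal (real k / 2 - real k / 2 / real n)"
  let ?d = "real k * (real k + 1) / (2 * real k + 1)"
  let ?u = "\<lambda>n. ereal (?d + (real k)\<^sup>2 / real n)"
  \<comment> \<open>\<open>?l\<close> and \<open>?u\<close> enclose the ratio only for \<open>n \<ge> 2k + 1\<close>, where cov-sat graphs are known to exist.\<close>
  have "?l \<longlonglongrightarrow> ereal (real k / 2 - 0)"
    by (intro tendsto_ereal tendsto_diff tendsto_const lim_const_over_n)
  then have "liminf ?l = ereal (real k / 2)"
    by (intro lim_imp_Liminf) simp_all
  moreover have "liminf ?l \<le> liminf ?c"
    unfolding r
    by (intro Liminf_mono eventually_sequentiallyI[of "2 * k + 1"])
      (simp only: ereal_less_eq csat_star_ratio_bounds(1)[OF k])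
  ultimately have lower: "ereal ((real r - 1) / 2) \<le> liminf ?c" by (simp add: r)
  have "?u \<longlonglongrightarrow> ereal (?d + 0)"
    by (intro tendsto_ereal tendsto_add tendsto_const lim_const_over_n)
  then have "limsup ?u = ereal ?d"
    by (intro lim_imp_Limsup) simp_all
  moreover have "limsup ?c \<le> limsup ?u"
    unfolding r
    by (intro Limsup_mono eventually_sequentiallyI[of "2 * k + 1"])
      (simp only: ereal_less_eq csat_star_ratio_bounds(2)[OF k])
  ultimately have "limsup ?c \<le> ereal ?d" by (simp only:)
  moreover have "?d + 1 / 4 = (real r - 1) / 2 + (4 * real r - 3) / (8 * real r - 4)"
  proof -
    have "8 * real r - 4 = 4 * (2 * real k + 1)" "2 * real k + 1 > 0" by (auto simp: r)
    then show ?thesis by (simp add: r divide_simps) (simp add: algebra_simps)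
  qed
  then have "ereal ?d \<le> ereal ((real r - 1) / 2 + (4 * real r - 3) / (8 * real r - 4))"
    unfolding ereal_less_eq by linarith
  ultimately have upper:
    "limsup ?c \<le> ereal ((real r - 1) / 2 + (4 * real r - 3) / (8 * real r - 4))"
    by (rule order_trans)
  have "liminf ?c \<le> limsup ?c" by (rule Liminf_le_Limsup) simp
  with lower upper show ?thesis by blast
qed

end
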